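(* Suppose $\delta_n^\infty = o_p(r_n)$ as $n\to\infty$, where $\delta_n^\infty=\sup_{\theta\in\Theta}\|\nabla_\theta\tilde\ell_n(\theta)-\nabla_\theta\ell_n(\theta)\|$ is the uniform error in the approximate score function. Then the approximate maximum likelihood estimator satisfies $\tilde\theta_n\to\theta_0$ in probability as $n\to\infty$.
   Context: A sequence of statistical models indexed by $n$ has common parameter $\theta\in\Theta\subseteq\mathbb{R}^p$ ($p$ fixed). For data $y$ from model $n$, $\ell_n(\theta)=\ell_n(\theta;y)$ is the log-likelihood and $u_n(\theta)=\nabla_\theta\ell_n(\theta)$ the score. The data are generated from the model with true parameter $\theta_0\in\Theta$, and all $o_p$ statements and convergence in probability refer to this distribution. The deterministic sequence $r_n>0$, $r_n\to\infty$, is the rate at which information grows: $-\nabla_\theta^T\nabla_\theta\ell_n(\theta_0)=O_p(r_n)$. An approximate log-likelihood $\tilde\ell_n(\theta)=\tilde\ell_n(\theta;y)$ is any function of $\theta$ (and the data) used in place of $\ell_n$. Both $\ell_n$ and $\tilde\ell_n$ are three times differentiable in $\theta$. Write $\tilde u_n=\nabla_\theta\tilde\ell_n$. The estimator $\tilde\theta_n$ maximizes $\tilde\ell_n$ over $\Theta$ and solves $\tilde u_n(\tilde\theta_n)=0$. The vector norm is $\|a\|=\sum_i|a_i|$. Standing regularity conditions: with $\bar u_n(\theta)=r_n^{-1}u_n(\theta)$, there is a deterministic limit function $\bar u:\Theta\to\mathbb{R}^p$ such that $\sup_{\theta\in\Theta}\|\bar u_n(\theta)-\bar u(\theta)\|\to0$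 in probability, and for every $\epsilon>0$, $\inf_{\theta\in\Theta:\,\|\theta-\theta_0\|\ge\epsilon}\|\bar u(\theta)\|>0=\|\bar u(\theta_0)\|$. *)

theory Defs
  imports "HOL-Probability.Probability"
begin

definition l1_norm :: "real ^ 'p \<Rightarrow> real" where
  "l1_norm a = (\<Sum>i\<in>UNIV. \<bar>a $ i\<bar>)"

text \<open>
  A statistical model is given by a dominating measure \<open>\<mu>\<close> on the sample space and a
  family of densities \<open>f \<theta>\<close> with respect to \<open>\<mu>\<close>, indexed by \<open>\<theta> \<in> \<Theta>\<close>.
\<close>

definition model_distr :: "'y measure \<Rightarrow> ('t \<Rightarrow> 'y \<Rightarrow> real) \<Rightarrow> 't \<Rightarrow> 'y measure" where
  "model_distr \<mu> f \<theta> = density \<mu> (\<lambda>y. ennreal (f \<theta> y))"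

definition statistical_model :: "'t set \<Rightarrow> 'y measure \<Rightarrow> ('t \<Rightarrow> 'y \<Rightarrow> real) \<Rightarrow> bool" where
  "statistical_model \<Theta> \<mu> f \<longleftrightarrow>
     (\<forall>\<theta>\<in>\<Theta>. f \<theta> \<in> borel_measurable \<mu> \<and> (\<forall>y\<in>space \<mu>. 0 \<le> f \<theta> y) \<and>
            prob_space (model_distr \<mu> f \<theta>))"

text \<open>\<open>ln\<close> takes an arbitrary value at \<open>0\<close>, so this is meaningful only where the density is positive.\<close>

definition log_lik :: "('t \<Rightarrow> 'y \<Rightarrow> real) \<Rightarrow> 't \<Rightarrow> 'y \<Rightarrow> real" where
  "log_lik f \<theta> y = ln (f \<theta> y)"

text \<open>
  Derivatives are taken within \<open>S\<close>, so that a function defined only on a parameter set that is not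
  open is covered as well; at interior points of \<open>S\<close> they are the ordinary derivatives.
\<close>

definition three_times_differentiable_on ::
  "(real ^ 'p \<Rightarrow> real) \<Rightarrow> (real ^ 'p \<Rightarrow> real ^ 'p) \<Rightarrow> (real ^ 'p \<Rightarrow> real ^ 'p ^ 'p) \<Rightarrow> (real ^ 'p) set \<Rightarrow> bool"
  where
  "three_times_differentiable_on l u H S \<longleftrightarrow>
     (\<forall>x\<in>S. (l has_derivative (\<lambda>h. u x \<bullet> h)) (at x within S)) \<and>
     (\<forall>x\<in>S. (u has_derivative (\<lambda>h. H x *v h)) (at x within S)) \<and>
     H differentiable_on S"

text \<open>
  Stochastic orders for random magnitudes \<open>X n\<close> on the probability spaces \<open>M n\<close>. The magnitudes
  are extended nonnegative, because a supremum over the parameter set may be infinite.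
\<close>

definition little_o_p :: "(nat \<Rightarrow> 'y measure) \<Rightarrow> (nat \<Rightarrow> 'y \<Rightarrow> ennreal) \<Rightarrow> (nat \<Rightarrow> real) \<Rightarrow> bool" where
  "little_o_p M X r \<longleftrightarrow>
     (\<forall>n. X n \<in> borel_measurable (M n)) \<and>
     (\<forall>\<epsilon>>0. (\<lambda>n. measure (M n) {y \<in> space (M n). X n y > ennreal (\<epsilon> * r n)}) \<longlonglongrightarrow> 0)"

definition big_O_p :: "(nat \<Rightarrow> 'y measure) \<Rightarrow> (nat \<Rightarrow> 'y \<Rightarrow> ennreal) \<Rightarrow> (nat \<Rightarrow> real) \<Rightarrow> bool" where
  "big_O_p M X r \<longleftrightarrow>
     (\<forall>n. X n \<in> borel_measurable (M n)) \<and>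
     (\<forall>\<epsilon>>0. \<exists>K>0. \<forall>\<^sub>F n in sequentially.
        measure (M n) {y \<in> space (M n). X n y > ennreal (K * r n)} < \<epsilon>)"

definition tendsto_in_prob ::
  "(nat \<Rightarrow> 'y measure) \<Rightarrow> (nat \<Rightarrow> 'y \<Rightarrow> real ^ 'p) \<Rightarrow> real ^ 'p \<Rightarrow> bool" where
  "tendsto_in_prob M X x \<longleftrightarrow>
     (\<forall>n. X n \<in> borel_measurable (M n)) \<and>
     (\<forall>\<epsilon>>0. (\<lambda>n. measure (M n) {y \<in> space (M n). l1_norm (X n y - x) > \<epsilon>}) \<longlonglongrightarrow> 0)"

definition sup_l1_dist ::
  "'t set \<Rightarrow> ('t \<Rightarrow> real ^ 'p) \<Rightarrow> ('t \<Rightarrow> real ^ 'p) \<Rightarrow> ennreal" where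
  "sup_l1_dist \<Theta> g h = (SUP \<theta>\<in>\<Theta>. ennreal (l1_norm (g \<theta> - h \<theta>)))"

end

theory Submission
  imports Defs
begin

text \<open>
  Since \<open>u_approx\<close> vanishes at the estimator, the limiting score there has norm at most the sum of
  the two uniform errors, after scaling by \<open>r\<close>. Well-separatedness bounds that norm below by a
  constant whenever the estimator is far from \<open>\<theta>0\<close>, so up to null sets this event is contained in
  the union of the two events that a uniform error is large.
\<close>

lemma l1_norm_triangle: "l1_norm (a + b) \<le> l1_norm a + l1_norm b"
  unfolding l1_norm_def by (simp add: sum.distrib[symmetric] sum_mono)

lemma l1_norm_minus: "l1_norm (- a) = l1_norm a"
  by (simp add: l1_norm_def)

lemma l1_norm_scaleR: "l1_norm (c *\<^sub>R a) = \<bar>c\<bar> * l1_norm a"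
  by (simp add: l1_norm_def abs_mult sum_distrib_left)

text \<open>Turns failure of an \<open>ennreal\<close> tail event into a real bound at a single
  parameter. The sign condition on \<open>c\<close> matters because \<open>ennreal\<close> sends
  negative reals to 0.\<close>

lemma l1_norm_le_sup_l1_dist:
  assumes "sup_l1_dist S g h \<le> ennreal c" "0 \<le> c" "x \<in> S"
  shows "l1_norm (g x - h x) \<le> c"
proof -
  have "ennreal (l1_norm (g x - h x)) \<le> ennreal c"
    using assms(1,3) unfolding sup_l1_dist_def SUP_le_iff by blast
  then show ?thesis
    using assms(2) by simp
qed

theorem theorem1:
  fixes \<Theta> :: "(real ^ 'p) set" and \<theta>0 :: "real ^ 'p"
    and \<mu> :: "nat \<Rightarrow> 'y measure"
    and f :: "nat \<Rightarrow> real ^ 'p \<Rightarrow> 'y \<Rightarrow> real"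
    and P :: "nat \<Rightarrow> 'y measure"
    and l l_approx :: "nat \<Rightarrow> real ^ 'p \<Rightarrow> 'y \<Rightarrow> real"
    and u u_approx :: "nat \<Rightarrow> real ^ 'p \<Rightarrow> 'y \<Rightarrow> real ^ 'p"
    and H H_approx :: "nat \<Rightarrow> real ^ 'p \<Rightarrow> 'y \<Rightarrow> real ^ 'p ^ 'p"
    and r :: "nat \<Rightarrow> real"
    and ubar :: "real ^ 'p \<Rightarrow> real ^ 'p"
    and \<theta>_approx :: "nat \<Rightarrow> 'y \<Rightarrow> real ^ 'p"
  assumes true_param: "\<theta>0 \<in> \<Theta>"
    and model: "\<And>n. statistical_model \<Theta> (\<mu> n) (f n)"
    and P_def: "\<And>n. P n = model_distr (\<mu> n) (f n) \<theta>0"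
    and l_def: "\<And>n. l n = log_lik (f n)"
    and density_pos: "\<And>n. AE y in P n. \<forall>\<theta>\<in>\<Theta>. f n \<theta> y > 0"
    and l_smooth: "\<And>n. AE y in P n.
          three_times_differentiable_on (\<lambda>\<theta>. l n \<theta> y) (\<lambda>\<theta>. u n \<theta> y) (\<lambda>\<theta>. H n \<theta> y) \<Theta>"
    and l_approx_smooth: "\<And>n. AE y in P n.
          three_times_differentiable_on (\<lambda>\<theta>. l_approx n \<theta> y) (\<lambda>\<theta>. u_approx n \<theta> y)
            (\<lambda>\<theta>. H_approx n \<theta> y) \<Theta>"
    and r_pos: "\<And>n. r n > 0"
    and r_lim: "filterlim r at_top sequentially"
    and information_rate: "\<And>i j. big_O_p P (\<lambda>n y. ennreal \<bar>(- H n \<theta>0 y) $ i $ j\<bar>) r"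
    and score_limit:
      "little_o_p P (\<lambda>n y. sup_l1_dist \<Theta> (\<lambda>\<theta>. (1 / r n) *\<^sub>R u n \<theta> y) ubar) (\<lambda>n. 1)"
    and well_separated:
      "\<And>\<epsilon>. \<epsilon> > 0 \<Longrightarrow> (INF \<theta>\<in>{\<theta>\<in>\<Theta>. l1_norm (\<theta> - \<theta>0) \<ge> \<epsilon>}. ennreal (l1_norm (ubar \<theta>))) > 0"
    and ubar_zero: "l1_norm (ubar \<theta>0) = 0"
    and estimator_measurable: "\<And>n. \<theta>_approx n \<in> borel_measurable (P n)"
    and estimator: "\<And>n. AE y in P n. \<theta>_approx n y \<in> \<Theta> \<and>
          (\<forall>\<theta>\<in>\<Theta>. l_approx n \<theta> y \<le> l_approx n (\<theta>_approx n y) y) \<and>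
          u_approx n (\<theta>_approx n y) y = 0"
    and score_error:
      "little_o_p P (\<lambda>n y. sup_l1_dist \<Theta> (\<lambda>\<theta>. u_approx n \<theta> y) (\<lambda>\<theta>. u n \<theta> y)) r"
  shows "tendsto_in_prob P \<theta>_approx \<theta>0"
  unfolding tendsto_in_prob_def
proof (intro conjI allI impI estimator_measurable)
  fix \<epsilon> :: real
  assume "\<epsilon> > 0"
  \<comment> \<open>The infimum is \<open>top\<close> when no parameter lies at distance at least
    \<open>\<epsilon>\<close> from \<open>\<theta>0\<close>, so it cannot itself serve as a real
    constant. A value strictly below it is always finite, and makes the lower bound in
    \<open>separated\<close> strict.\<close>
  from well_separated[OF this] obtain c' :: ennreal
    where c': "0 < c'"
      "c' < (INF \<theta>\<in>{\<theta>\<in>\<Theta>. l1_norm (\<theta> - \<theta>0) \<ge> \<epsilon>}. ennreal (l1_norm (ubar \<theta>)))"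
    using dense by blast
  define c where "c = enn2real c'"
  have "c' < top"
    using c'(2) by (rule less_le_trans) simp
  then have c'_eq: "c' = ennreal c"
    by (simp add: c_def)
  have "c > 0"
    using c'(1) by (simp add: c'_eq)
  have separated: "l1_norm (ubar \<theta>) > c" if "\<theta> \<in> \<Theta>" "l1_norm (\<theta> - \<theta>0) \<ge> \<epsilon>" for \<theta>
  proof -
    have "ennreal c < ennreal (l1_norm (ubar \<theta>))"
      using less_INF_D[OF c'(2), of \<theta>] that by (simp add: c'_eq)
    then show ?thesis
      using \<open>c > 0\<close> by (simp add: ennreal_less_iff)
  qed
  \<comment> \<open>Each error gets half of the separation constant \<open>c\<close>. The factor 1
    only matches the shape of \<open>little_o_p\<close> at constant rate.\<close>
  define A where "A n = {y \<in> space (P n).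
    sup_l1_dist \<Theta> (\<lambda>\<theta>. (1 / r n) *\<^sub>R u n \<theta> y) ubar > ennreal (c / 2 * 1)}" for n
  define B where "B n = {y \<in> space (P n).
    sup_l1_dist \<Theta> (\<lambda>\<theta>. u_approx n \<theta> y) (\<lambda>\<theta>. u n \<theta> y) > ennreal (c / 2 * r n)}" for n
  \<comment> \<open>A supremum over an uncountable parameter set need not be measurable; here
    measurability is part of \<open>little_o_p\<close>.\<close>
  note [measurable] = score_limit[unfolded little_o_p_def, THEN conjunct1, rule_format]
    score_error[unfolded little_o_p_def, THEN conjunct1, rule_format]
  have [measurable]: "A n \<in> sets (P n)" "B n \<in> sets (P n)" for n
    unfolding A_def B_def by measurable
  have "(\<lambda>n. measure (P n) (A n)) \<longlonglongrightarrow> 0" "(\<lambda>n. measure (P n) (B n)) \<longlonglongrightarrow> 0"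
    unfolding A_def B_def
    by (rule score_limit[unfolded little_o_p_def, THEN conjunct2, rule_format]
          score_error[unfolded little_o_p_def, THEN conjunct2, rule_format], use \<open>c > 0\<close> in simp)+
  from tendsto_add[OF this] have lim: "(\<lambda>n. measure (P n) (A n) + measure (P n) (B n)) \<longlonglongrightarrow> 0"
    by simp
  have far_event: "y \<in> A n \<union> B n"
    if y: "y \<in> space (P n)" and far: "l1_norm (\<theta>_approx n y - \<theta>0) > \<epsilon>"
      and est: "\<theta>_approx n y \<in> \<Theta>" "u_approx n (\<theta>_approx n y) y = 0" for n y
  proof (rule ccontr)
    let ?t = "\<theta>_approx n y"
    let ?v = "(1 / r n) *\<^sub>R u n ?t y"
    assume not_in: "y \<notin> A n \<union> B n"
    have limit_err: "l1_norm (?v - ubar ?t) \<le> c / 2"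
      using not_in y est \<open>c > 0\<close>
      by (intro l1_norm_le_sup_l1_dist[where S = \<Theta>]) (auto simp: A_def not_less)
    have "l1_norm (u_approx n ?t y - u n ?t y) \<le> c / 2 * r n"
      using not_in y est \<open>c > 0\<close> r_pos[of n]
      by (intro l1_norm_le_sup_l1_dist[where S = \<Theta>]) (auto simp: B_def not_less)
    \<comment> \<open>As \<open>u_approx\<close> vanishes at \<open>?t\<close>, the score error
      there is the norm of \<open>u n ?t y\<close> itself; dividing by \<open>r n\<close> gives the
      claim.\<close>
    then have "l1_norm ?v \<le> c / 2"
      using est r_pos[of n] by (simp add: l1_norm_minus l1_norm_scaleR field_simps)
    moreover have "l1_norm (ubar ?t) \<le> l1_norm ?v + l1_norm (?v - ubar ?t)"
      using l1_norm_triangle[of ?v "- (?v - ubar ?t)"] by (simp only: l1_norm_minus) simp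
    \<comment> \<open>The two halves add up to exactly \<open>c\<close>, which the strict bound in
      \<open>separated\<close> excludes.\<close>
    ultimately show False
      using separated[of ?t] limit_err est far by simp
  qed
  have "measure (P n) {y \<in> space (P n). l1_norm (\<theta>_approx n y - \<theta>0) > \<epsilon>}
      \<le> measure (P n) (A n) + measure (P n) (B n)" for n
  proof -
    interpret prob_space "P n"
      using model[of n] true_param by (simp add: statistical_model_def P_def)
    have "prob {y \<in> space (P n). l1_norm (\<theta>_approx n y - \<theta>0) > \<epsilon>} \<le> prob (A n \<union> B n)"
    proof (rule finite_measure_mono_AE)
      \<comment> \<open>The estimator lies in \<open>\<Theta>\<close> and solves the score equation
        only almost surely, so \<open>far_event\<close> yields inclusion up to a null set.\<close>
      show "AE y in P n. y \<in> {y \<in> space (P n). l1_norm (\<theta>_approx n y - \<theta>0) > \<epsilon>}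
          \<longrightarrow> y \<in> A n \<union> B n"
        using estimator[of n] by eventually_elim (use far_event in blast)
    qed simp
    also have "\<dots> \<le> prob (A n) + prob (B n)"
      by (rule measure_Un_le) simp_all
    finally show ?thesis .
  qed
  then show "(\<lambda>n. measure (P n) {y \<in> space (P n). l1_norm (\<theta>_approx n y - \<theta>0) > \<epsilon>}) \<longlonglongrightarrow> 0"
    by (intro tendsto_sandwich[OF _ _ tendsto_const lim]) simp_all
qed

end
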